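(* Let $\mathcal{M} = \mathcal{SO}(3)\times\mathbb{R}^3\times\mathcal{SO}(3)$ with elements $\xi=((\mathbf{R},\boldsymbol{b}),\mathbf{C})$, let $\mathbb{L}=\{(\boldsymbol{\omega},\mathbf{0},\mathbf{0}):\boldsymbol{\omega}\in\mathbb{R}^3\}\subset\mathbb{R}^9$, and consider the biased attitude system $\dot\xi=f(\xi,u)=f_u(\xi)=(\mathbf{R}(\boldsymbol{\omega}-\boldsymbol{b})^{\wedge},\mathbf{0},\mathbf{0}^{\wedge})$. Let $\mathbf{G} = (\mathbf{SO}(3)\ltimes\mathfrak{so}(3))\times\mathbf{SO}(3)$, with Lie algebra $\mathfrak{g}$. Define $\Lambda:\mathcal{M}\times\mathbb{L}\to\mathfrak{g}$ by $$\Lambda(\xi,u):=\Big(\big((\boldsymbol{\omega}-\boldsymbol{b})^{\wedge},\;-(\boldsymbol{\omega}^{\wedge}\boldsymbol{b})^{\wedge}\big),\;\mathbf{C}^{\top}(\boldsymbol{\omega}-\boldsymbol{b})^{\wedge}\mathbf{C}\Big).$$ Then $\Lambda$ is an equivariant lift for the system with respect to the symmetry group $\mathbf{G}$ (with its actions $\phi$ on $\mathcal{M}$ and $\psi$ on $\mathbb{L}$ given by $\phi(X,\xi)=(\mathbf{R}A,\,A^{\top}(\boldsymbol{b}-a^{\vee}),\,A^{\top}\mathbf{C}B)$ and $\psi(X,u)=(A^{\top}(\boldsymbol{\omega}-a^{\vee}),\mathbf{0},\mathbf{0})$ for $X=((A,a),B)\in\mathbf{G}$).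
   Context: $\mathcal{SO}(3)$ denotes the underlying smooth manifold of $\mathbf{SO}(3)$. For $\boldsymbol{v}\in\mathbb{R}^3$, $\boldsymbol{v}^{\wedge}\in\mathfrak{so}(3)$ is the skew-symmetric matrix with $\boldsymbol{v}^{\wedge}\boldsymbol{w}=\boldsymbol{v}\times\boldsymbol{w}$, and $(\cdot)^{\vee}$ is its inverse. The group product in $\mathbf{G}$ is $XY=((A_XA_Y,\,a_X+A_Xa_YA_X^{\top}),\,B_XB_Y)$, with inverse $X^{-1}=((A^{\top},-A^{\top}aA),B^{\top})$. Its Lie algebra is identified with triples $((\gamma,\zeta),\kappa)$, $\gamma,\zeta,\kappa\in\mathfrak{so}(3)$, and its adjoint map is $$\mathrm{Ad}_X[((\gamma,\zeta),\kappa)]=\big((A\gamma A^{\top},\;A\zeta A^{\top}+[a,A\gamma A^{\top}]),\;B\kappa B^{\top}\big).$$ A map $\Lambda:\mathcal{M}\times\mathbb{L}\to\mathfrak{g}$ is a lift if $\mathrm{d}\phi_{\xi}[\Lambda(\xi,u)]:=\mathrm{D}_X\big|_{I}\phi_{\xi}(X)[\Lambda(\xi,u)]=f(\xi,u)$ for all $\xi\in\mathcal{M}$, $u\in\mathbb{L}$, where $\phi_\xi(X)=\phi(X,\xi)$. It is an equivariant lift if in addition $\mathrm{Ad}_{X^{-1}}[\Lambda(\xi,u)]=\Lambda(\phi_X(\xi),\psi_X(u))$ for all $X\in\mathbf{G}$, where $\phi_X(\xi)=\phi(X,\xi)$ and $\psi_X(u)=\psi(X,u)$. *)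

theory Defs
  imports "HOL-Analysis.Analysis" "HOL-Algebra.Group"
begin

text \<open>
  Matrix Lie groups, their Lie algebras and the state manifold are subsets of the ambient
  Euclidean spaces of matrices and vectors, so tangent vectors are elements of the ambient space.
\<close>

type_synonym mat3 = "real^3^3"
type_synonym state = "(mat3 \<times> (real^3)) \<times> mat3"
type_synonym input = "(real^3) \<times> (real^3) \<times> (real^3)"
type_synonym triple = "(mat3 \<times> mat3) \<times> mat3"

definition SO3 :: "mat3 set"
  where "SO3 = {A. rotation_matrix A}"

definition so3 :: "mat3 set"
  where "so3 = {M. transpose M = - M}"

definition wedge :: "real^3 \<Rightarrow> mat3"
  where "wedge v = matrix (cross3 v)"

text \<open>Meaningful only on \<open>so3\<close>, where it is the two-sided inverse of \<open>wedge\<close>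
  (lemmas \<open>vee_wedge\<close> and \<open>wedge_vee\<close> below).\<close>

definition vee :: "mat3 \<Rightarrow> real^3"
  where "vee = inv_into UNIV wedge"

definition commutator :: "mat3 \<Rightarrow> mat3 \<Rightarrow> mat3"
  where "commutator a b = a ** b - b ** a"


definition GG :: "triple monoid"
  where "GG = \<lparr>carrier = (SO3 \<times> so3) \<times> SO3,
    monoid.mult = (\<lambda>((A, a), B) ((A', a'), B').
      ((A ** A', a + A ** a' ** transpose A), B ** B')),
    one = ((mat 1, 0), mat 1)\<rparr>"

definition gg :: "triple set"
  where "gg = (so3 \<times> so3) \<times> so3"

definition Ad :: "triple \<Rightarrow> triple \<Rightarrow> triple"
  where "Ad = (\<lambda>((A, a), B) ((\<gamma>, \<zeta>), \<kappa>).
    ((A ** \<gamma> ** transpose A,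
      A ** \<zeta> ** transpose A + commutator a (A ** \<gamma> ** transpose A)),
     B ** \<kappa> ** transpose B))"


definition MM :: "state set"
  where "MM = (SO3 \<times> UNIV) \<times> SO3"

definition LL :: "input set"
  where "LL = {(\<omega>, 0, 0) |\<omega>. True}"

definition sysf :: "state \<Rightarrow> input \<Rightarrow> state"
  where "sysf = (\<lambda>((R, b), C) (\<omega>, _, _). ((R ** wedge (\<omega> - b), 0), wedge 0))"

definition phi :: "triple \<Rightarrow> state \<Rightarrow> state"
  where "phi = (\<lambda>((A, a), B) ((R, b), C).
    ((R ** A, transpose A *v (b - vee a)), transpose A ** C ** B))"

definition psi :: "triple \<Rightarrow> input \<Rightarrow> input"
  where "psi = (\<lambda>((A, a), B) (\<omega>, _, _). (transpose A *v (\<omega> - vee a), 0, 0))"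

definition Lam :: "state \<Rightarrow> input \<Rightarrow> triple"
  where "Lam = (\<lambda>((R, b), C) (\<omega>, _, _).
    ((wedge (\<omega> - b), - wedge (wedge \<omega> *v b)),
     transpose C ** wedge (\<omega> - b) ** C))"


text \<open>
  The differential of \<open>\<lambda>X. \<phi> X \<xi>\<close> at the identity is taken along the submanifold
  \<open>carrier GG\<close> of the ambient space.  The map \<open>D\<close> is not unique as a linear map on the
  ambient space, but it is unique on \<open>gg\<close>, the tangent space at the identity
  (lemma \<open>differential_unique\<close> below), where alone it is evaluated.
\<close>

definition is_lift ::
  "(triple \<Rightarrow> state \<Rightarrow> state) \<Rightarrow> (state \<Rightarrow> input \<Rightarrow> state) \<Rightarrow> (state \<Rightarrow> input \<Rightarrow> triple) \<Rightarrow> bool"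
  where "is_lift \<phi> f \<Lambda> \<longleftrightarrow>
    (\<forall>\<xi>\<in>MM. \<forall>u\<in>LL. \<Lambda> \<xi> u \<in> gg \<and>
      (\<exists>D. ((\<lambda>X. \<phi> X \<xi>) has_derivative D) (at \<one>\<^bsub>GG\<^esub> within carrier GG) \<and>
           D (\<Lambda> \<xi> u) = f \<xi> u))"

definition is_equivariant_lift ::
  "(triple \<Rightarrow> state \<Rightarrow> state) \<Rightarrow> (triple \<Rightarrow> input \<Rightarrow> input) \<Rightarrow> (state \<Rightarrow> input \<Rightarrow> state) \<Rightarrow>
   (state \<Rightarrow> input \<Rightarrow> triple) \<Rightarrow> bool"
  where "is_equivariant_lift \<phi> \<psi> f \<Lambda> \<longleftrightarrow>
    is_lift \<phi> f \<Lambda> \<and>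
    (\<forall>X\<in>carrier GG. \<forall>\<xi>\<in>MM. \<forall>u\<in>LL.
      Ad (inv\<^bsub>GG\<^esub> X) (\<Lambda> \<xi> u) = \<Lambda> (\<phi> X \<xi>) (\<psi> X u))"


lemma wedge_mult: "wedge v *v w = cross3 v w"
proof -
  have "linear (cross3 v)"
    using bilinear_cross by (simp add: bilinear_def)
  then show ?thesis
    by (simp add: wedge_def matrix_works)
qed

lemma wedge_nth:
  "wedge v $ 1 $ 1 = 0" "wedge v $ 1 $ 2 = - v$3" "wedge v $ 1 $ 3 = v$2"
  "wedge v $ 2 $ 1 = v$3" "wedge v $ 2 $ 2 = 0" "wedge v $ 2 $ 3 = - v$1"
  "wedge v $ 3 $ 1 = - v$2" "wedge v $ 3 $ 2 = v$1" "wedge v $ 3 $ 3 = 0"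
  by (simp_all add: wedge_def matrix_def cross3_def axis_def)

lemma vee_wedge: "vee (wedge v) = v"
proof -
  have "inj wedge"
  proof (rule injI)
    fix v w assume "wedge v = wedge w"
    then have "wedge v $ i $ j = wedge w $ i $ j" for i j by simp
    from this[of 3 2] this[of 1 3] this[of 2 1] show "v = w"
      by (simp add: vec_eq_iff forall_3 wedge_nth)
  qed
  then show ?thesis by (simp add: vee_def)
qed

lemma wedge_in_so3: "wedge v \<in> so3"
  by (simp add: so3_def vec_eq_iff forall_3 transpose_def wedge_nth)

lemma wedge_vee: "M \<in> so3 \<Longrightarrow> wedge (vee M) = M"
proof -
  assume "M \<in> so3"
  then have M: "transpose M = - M"
    by (simp add: so3_def)
  have skew: "M $ i $ j = - M $ j $ i" for i j
    using arg_cong[OF M, of "\<lambda>N. N $ j $ i"] by (simp only: transpose_def vec_lambda_beta uminus_vec_def)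
  have diag: "M $ i $ i = 0" for i
    using skew[of i i] by linarith
  define v :: "real^3" where "v = vector [M$3$2, M$1$3, M$2$1]"
  have "wedge v = M"
    by (simp add: vec_eq_iff forall_3 wedge_nth diag v_def skew[of 1 2] skew[of 2 3] skew[of 3 1])
  then show ?thesis
    using vee_wedge[of v] by simp
qed

lemma wedge_rotate:
  assumes "A \<in> SO3"
  shows "wedge (A *v v) = A ** wedge v ** transpose A"
proof -
  have A: "A ** transpose A = mat 1" "rotation_matrix A"
    using assms by (auto simp: SO3_def rotation_matrix_def orthogonal_matrix_def)
  have "wedge (A *v v) *v w = (A ** wedge v ** transpose A) *v w" for w
  proof -
    have "wedge (A *v v) *v w = cross3 (A *v v) (A *v (transpose A *v w))"
      by (simp add: wedge_mult matrix_vector_mul_assoc A del: transpose_matrix_vector)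
    also have "\<dots> = A *v (cross3 v (transpose A *v w))"
      by (rule cross_rotation_matrix[OF A(2)])
    finally show ?thesis
      by (simp add: wedge_mult del: transpose_matrix_vector flip: matrix_vector_mul_assoc)
  qed
  then show ?thesis by (simp add: matrix_eq)
qed

lemma SO3_closed:
  "mat 1 \<in> SO3" "A \<in> SO3 \<Longrightarrow> B \<in> SO3 \<Longrightarrow> A ** B \<in> SO3" "A \<in> SO3 \<Longrightarrow> transpose A \<in> SO3"
  by (auto simp: SO3_def rotation_matrix_def orthogonal_matrix_id orthogonal_matrix_mul det_mul)

lemma SO3_inverse:
  "A \<in> SO3 \<Longrightarrow> A ** transpose A = mat 1" "A \<in> SO3 \<Longrightarrow> transpose A ** A = mat 1"
  by (auto simp: SO3_def rotation_matrix_def orthogonal_matrix_def)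

lemma so3_conj: "M \<in> so3 \<Longrightarrow> A \<in> SO3 \<Longrightarrow> A ** M ** transpose A \<in> so3"
  using wedge_rotate[of A "vee M"] wedge_in_so3[of "A *v vee M"] by (simp add: wedge_vee)

lemma so3_linear: "0 \<in> so3" "M \<in> so3 \<Longrightarrow> N \<in> so3 \<Longrightarrow> M + N \<in> so3" "M \<in> so3 \<Longrightarrow> - M \<in> so3"
proof -
  have "transpose (0 :: mat3) = 0"
    by (simp add: transpose_def vec_eq_iff)
  moreover have "transpose (M + N) = transpose M + transpose N" "transpose (- M) = - transpose M"
    by (simp_all add: transpose_def vec_eq_iff)
  ultimately show "0 \<in> so3" "M \<in> so3 \<Longrightarrow> N \<in> so3 \<Longrightarrow> M + N \<in> so3" "M \<in> so3 \<Longrightarrow> - M \<in> so3"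
    by (simp_all add: so3_def)
qed

lemma vee_conj: "M \<in> so3 \<Longrightarrow> A \<in> SO3 \<Longrightarrow> vee (A ** M ** transpose A) = A *v vee M"
  using wedge_rotate[of A "vee M"] vee_wedge[of "A *v vee M"] by (simp add: wedge_vee)

lemma wedge_add: "wedge (v + w) = wedge v + wedge w"
  by (simp add: vec_eq_iff forall_3 wedge_nth)

lemma vee_add: "M \<in> so3 \<Longrightarrow> N \<in> so3 \<Longrightarrow> vee (M + N) = vee M + vee N"
  using wedge_add[of "vee M" "vee N"] vee_wedge[of "vee M + vee N"] by (simp add: wedge_vee)

lemma inverse_formula_closed:
  "((A, a), B) \<in> carrier GG \<Longrightarrow>
   ((transpose A, - (transpose A ** a ** A)), transpose B) \<in> carrier GG"
  using so3_conj[of a "transpose A"] SO3_closed so3_linear by (auto simp: GG_def)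

lemma minus_matrix_mult: "(- A) ** B = - (A ** B)" "A ** (- B) = - (A ** B)" for A B :: mat3
  by (simp_all add: vec_eq_iff matrix_matrix_mult_def sum_negf)

lemma matrix_add_mult: "(A + B) ** C = A ** C + B ** C" for A B C :: mat3
  by (simp add: vec_eq_iff matrix_matrix_mult_def distrib_right sum.distrib)

lemma group_GG: "group GG"
proof (rule groupI)
  fix X assume X: "X \<in> carrier GG"
  obtain A a B where "X = ((A, a), B)"
    by (metis prod.exhaust)
  then show "\<exists>Y\<in>carrier GG. Y \<otimes>\<^bsub>GG\<^esub> X = \<one>\<^bsub>GG\<^esub>"
    using X by (intro bexI[OF _ inverse_formula_closed[of A a B]]) (auto simp: GG_def SO3_inverse)
qed (auto simp: GG_def SO3_closed so3_linear so3_conj matrix_mul_assoc matrix_add_ldistrib matrix_add_mult matrix_transpose_mul add.assoc)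

lemma inv_GG:
  assumes "((A, a), B) \<in> carrier GG"
  shows "inv\<^bsub>GG\<^esub> ((A, a), B) = ((transpose A, - (transpose A ** a ** A)), transpose B)"
proof (rule group.inv_equality[OF group_GG _ assms inverse_formula_closed[OF assms]])
  show "((transpose A, - (transpose A ** a ** A)), transpose B) \<otimes>\<^bsub>GG\<^esub> ((A, a), B) = \<one>\<^bsub>GG\<^esub>"
    using assms by (simp add: GG_def SO3_inverse)
qed

lemma transpose_so3_conj:
  "a \<in> so3 \<Longrightarrow> A \<in> SO3 \<Longrightarrow> transpose A *v vee (A ** a ** transpose A) = vee a"
  by (simp add: vee_conj matrix_vector_mul_assoc SO3_inverse del: transpose_matrix_vector)

lemma phi_right_action:
  "X \<in> carrier GG \<Longrightarrow> \<xi> \<in> MM \<Longrightarrow> phi X \<xi> \<in> MM"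
  "phi \<one>\<^bsub>GG\<^esub> \<xi> = \<xi>"
  "X \<in> carrier GG \<Longrightarrow> Y \<in> carrier GG \<Longrightarrow> phi Y (phi X \<xi>) = phi (X \<otimes>\<^bsub>GG\<^esub> Y) \<xi>"
proof -
  have [simp]: "vee 0 = 0"
    using vee_add[of 0 0] by (simp add: so3_linear)
  show "X \<in> carrier GG \<Longrightarrow> \<xi> \<in> MM \<Longrightarrow> phi X \<xi> \<in> MM"
    by (auto simp: GG_def MM_def phi_def SO3_closed)
  show "phi \<one>\<^bsub>GG\<^esub> \<xi> = \<xi>"
    by (simp add: GG_def phi_def split: prod.splits)
  show "X \<in> carrier GG \<Longrightarrow> Y \<in> carrier GG \<Longrightarrow> phi Y (phi X \<xi>) = phi (X \<otimes>\<^bsub>GG\<^esub> Y) \<xi>"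
    by (auto simp: GG_def phi_def matrix_mul_assoc matrix_transpose_mul vee_add so3_conj
        matrix_vector_mult_diff_distrib matrix_vector_right_distrib transpose_so3_conj
        simp del: transpose_matrix_vector simp flip: matrix_vector_mul_assoc split: prod.splits)
qed

lemma psi_right_action:
  "u \<in> LL \<Longrightarrow> psi X u \<in> LL"
  "u \<in> LL \<Longrightarrow> psi \<one>\<^bsub>GG\<^esub> u = u"
  "X \<in> carrier GG \<Longrightarrow> Y \<in> carrier GG \<Longrightarrow> psi Y (psi X u) = psi (X \<otimes>\<^bsub>GG\<^esub> Y) u"
proof -
  have [simp]: "vee 0 = 0"
    using vee_add[of 0 0] by (simp add: so3_linear)
  show "u \<in> LL \<Longrightarrow> psi X u \<in> LL"
    by (auto simp: LL_def psi_def split: prod.splits)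
  show "u \<in> LL \<Longrightarrow> psi \<one>\<^bsub>GG\<^esub> u = u"
    by (auto simp: GG_def LL_def psi_def)
  show "X \<in> carrier GG \<Longrightarrow> Y \<in> carrier GG \<Longrightarrow> psi Y (psi X u) = psi (X \<otimes>\<^bsub>GG\<^esub> Y) u"
    by (auto simp: GG_def psi_def matrix_mul_assoc matrix_transpose_mul vee_add so3_conj
        matrix_vector_mult_diff_distrib matrix_vector_right_distrib transpose_so3_conj
        simp del: transpose_matrix_vector simp flip: matrix_vector_mul_assoc split: prod.splits)
qed

text \<open>The curve below is the Cayley transform of \<open>(t / 2) *\<^sub>R V\<close>.\<close>

lemma SO3_curve:
  assumes "V \<in> so3"
  obtains c where "\<And>t. c t \<in> SO3" "c 0 = mat 1" "(c has_vector_derivative V) (at (0::real))"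
proof -
  define v where "v = vee V"
  define q where "q t = 1 + t\<^sup>2 * (v \<bullet> v) / 4" for t :: real
  define c where "c t = mat 1 + (t / q t) *\<^sub>R V + (t\<^sup>2 / (2 * q t)) *\<^sub>R (V ** V)" for t
  have V: "V = wedge v"
    by (simp add: v_def wedge_vee assms)
  have q: "q t \<noteq> 0" for t
    using inner_ge_zero[of v] by (smt (verit) q_def divide_nonneg_nonneg mult_nonneg_nonneg zero_le_power2)
  have cong1: "transpose (c t) ** c t = mat 1 \<and> det (c t) = 1" for t
  proof -
    define x y z where xyz: "x = v$1 * t / 2" "y = v$2 * t / 2" "z = v$3 * t / 2"
    define N where "N = 1 + x*x + y*y + z*z"
    define r where "r = inverse N"
    have N: "q t = N"
      by (simp add: q_def N_def xyz inner_vec_def sum_3 field_simps power2_eq_square)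
    have rN: "r * N = 1"
      using q[of t] by (simp add: r_def N)
    have e: "c t $ 1 $ 1 = r * (1 + x*x - y*y - z*z)" "c t $ 1 $ 2 = r * (2*x*y - 2*z)"
      "c t $ 1 $ 3 = r * (2*x*z + 2*y)" "c t $ 2 $ 1 = r * (2*x*y + 2*z)"
      "c t $ 2 $ 2 = r * (1 - x*x + y*y - z*z)" "c t $ 2 $ 3 = r * (2*y*z - 2*x)"
      "c t $ 3 $ 1 = r * (2*x*z - 2*y)" "c t $ 3 $ 2 = r * (2*y*z + 2*x)"
      "c t $ 3 $ 3 = r * (1 - x*x - y*y + z*z)"
      using q[of t] unfolding N
      by (simp_all add: c_def N r_def V matrix_matrix_mult_def sum_3 wedge_nth mat_def
          divide_simps)
        (simp_all add: xyz N_def field_simps power2_eq_square)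
    have rN2: "r * r * (N * N) = 1" and rN3: "r * r * r * (N * N * N) = 1"
      using rN by (algebra, algebra)
    have "transpose (c t) ** c t = mat 1"
      by (simp add: vec_eq_iff forall_3 matrix_matrix_mult_def sum_3 transpose_def mat_def e)
        (intro conjI; (rule trans[OF _ rN2])?; simp add: N_def algebra_simps)
    moreover have "det (c t) = 1"
      by (simp add: det_3 e) (rule trans[OF _ rN3], simp add: N_def algebra_simps)
    ultimately show ?thesis ..
  qed
  have "c t \<in> SO3" for t
    using cong1[of t] by (auto simp: SO3_def rotation_matrix_def orthogonal_matrix)
  moreover have "c 0 = mat 1"
    by (simp add: c_def)
  moreover have "(c has_vector_derivative V) (at 0)"
    unfolding c_def[abs_def] q_def
    by (auto intro!: derivative_eq_intros)
  ultimately show ?thesis by (rule that)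
qed

lemma differential_unique:
  fixes h :: "triple \<Rightarrow> 'a::real_normed_vector"
  assumes D: "(h has_derivative D) (at \<one>\<^bsub>GG\<^esub> within carrier GG)"
    and D': "(h has_derivative D') (at \<one>\<^bsub>GG\<^esub> within carrier GG)"
    and "\<eta> \<in> gg"
  shows "D \<eta> = D' \<eta>"
proof -
  obtain \<gamma> \<zeta> \<kappa> where \<eta>: "\<eta> = ((\<gamma>, \<zeta>), \<kappa>)" and mem: "\<gamma> \<in> so3" "\<zeta> \<in> so3" "\<kappa> \<in> so3"
    using assms(3) by (auto simp: gg_def)
  obtain c where c: "\<And>t. c t \<in> SO3" "c 0 = mat 1" "(c has_vector_derivative \<gamma>) (at 0)"
    using SO3_curve mem(1) by blast
  obtain d where d: "\<And>t. d t \<in> SO3" "d 0 = mat 1" "(d has_vector_derivative \<kappa>) (at 0)"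
    using SO3_curve mem(3) by blast
  define k where "k t = ((c t, t *\<^sub>R \<zeta>), d t)" for t :: real
  have k0: "k 0 = \<one>\<^bsub>GG\<^esub>"
    by (simp add: k_def c d GG_def)
  have "t *\<^sub>R \<zeta> \<in> so3" for t
    using mem(2) by (simp add: so3_def transpose_scalar)
  then have ran: "range k \<subseteq> carrier GG"
    by (auto simp: k_def GG_def c d)
  have "((\<lambda>t. t *\<^sub>R \<zeta>) has_vector_derivative \<zeta>) (at 0)"
    by (auto intro!: derivative_eq_intros)
  with c d have "(k has_vector_derivative \<eta>) (at 0)"
    unfolding k_def[abs_def] \<eta> by (intro has_vector_derivative_Pair)
  then have k: "(k has_derivative (\<lambda>t. t *\<^sub>R \<eta>)) (at 0)"
    by (simp add: has_vector_derivative_def)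
  have "((\<lambda>t. h (k t)) has_derivative (\<lambda>t. E (t *\<^sub>R \<eta>))) (at 0)"
    if "(h has_derivative E) (at \<one>\<^bsub>GG\<^esub> within carrier GG)" for E
    using has_derivative_in_compose[OF k, of h E] has_derivative_subset[OF that ran] k0 by simp
  then have "(\<lambda>t. D (t *\<^sub>R \<eta>)) = (\<lambda>t. D' (t *\<^sub>R \<eta>))"
    using D D' has_derivative_unique by blast
  from fun_cong[OF this, of 1] show ?thesis
    by simp
qed

end

theory Submission
  imports Defs
begin

lemma bounded_bilinear_matrix_mult: "bounded_bilinear ((**) :: real^'n^'m \<Rightarrow> real^'p^'n \<Rightarrow> real^'p^'m)"
  unfolding bilinear_conv_bounded_bilinear[symmetric] bilinear_def
  by (auto intro!: linearI simp: matrix_matrix_mult_def vec_eq_iff sum_distrib_left sum.distrib algebra_simps)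

lemma bounded_bilinear_matrix_vector_mult:
  "bounded_bilinear ((*v) :: real^'n^'m \<Rightarrow> real^'n \<Rightarrow> real^'m)"
  unfolding bilinear_conv_bounded_bilinear[symmetric] bilinear_def
  by (auto intro!: linearI simp: matrix_vector_mult_def vec_eq_iff sum_distrib_left
      sum.distrib algebra_simps)

lemma bounded_linear_transpose: "bounded_linear (transpose :: real^'n^'m \<Rightarrow> real^'m^'n)"
  unfolding linear_conv_bounded_linear[symmetric]
  by (auto intro!: linearI simp: transpose_scalar) (simp add: transpose_def vec_eq_iff)

text \<open>\<open>vee\<close> has unspecified values off \<open>so3\<close>, so derivatives in the ambient space
  are computed with this linear extension of its restriction to \<open>so3\<close>.\<close>

definition axial :: "mat3 \<Rightarrow> real^3"
  where "axial M = vector [M$3$2, M$1$3, M$2$1]"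

lemma bounded_linear_axial: "bounded_linear axial"
  unfolding linear_conv_bounded_linear[symmetric]
  by (auto intro!: linearI simp: axial_def vec_eq_iff forall_3)

lemma axial_wedge: "axial (wedge v) = v"
  by (simp add: axial_def vec_eq_iff forall_3 wedge_nth)

lemma axial_eq_vee: "M \<in> so3 \<Longrightarrow> axial M = vee M"
  by (metis axial_wedge wedge_vee)

lemma wedge_minus: "wedge (- v) = - wedge v"
  by (simp add: vec_eq_iff forall_3 wedge_nth)

text \<open>Turns the bracket term of \<open>Ad\<close> into a cross product, so that equivariance
  can be checked on vectors.\<close>

lemma commutator_wedge: "commutator (wedge v) (wedge w) = wedge (cross3 v w)"
  by (simp add: commutator_def vec_eq_iff forall_3 wedge_nth matrix_matrix_mult_def sum_3
      cross3_def algebra_simps)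

text \<open>The product rule at the identity, where both rotations are \<open>mat 1\<close> and the
  \<open>so3\<close> entry is 0, so that only the terms varying one factor at a time
  survive.\<close>

lemma phi_has_derivative:
  "((\<lambda>X. phi X ((R, b), C)) has_derivative
     (\<lambda>((\<gamma>, \<zeta>), \<kappa>). ((R ** \<gamma>, transpose \<gamma> *v b - axial \<zeta>), transpose \<gamma> ** C + C ** \<kappa>)))
   (at \<one>\<^bsub>GG\<^esub> within carrier GG)"
proof (rule has_derivative_transform)
  let ?F = "\<lambda>X :: triple. ((R ** fst (fst X),
      transpose (fst (fst X)) *v (b - axial (snd (fst X)))),
      transpose (fst (fst X)) ** C ** snd X)"
  show "\<one>\<^bsub>GG\<^esub> \<in> carrier GG"
    by (simp add: group.is_monoid group_GG monoid.one_closed)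
  \<comment> \<open>Agreement on the group suffices for a derivative within it; off the group the
    two maps may differ, since \<open>vee\<close> is unspecified there.\<close>
  show "phi X ((R, b), C) = ?F X" if "X \<in> carrier GG" for X
    using that by (auto simp: GG_def phi_def axial_eq_vee)
  have axial_0: "axial 0 = 0"
    by (rule linear_simps(3)[OF bounded_linear_axial])
  note [derivative_intros] =
    bounded_bilinear.FDERIV[OF bounded_bilinear_matrix_mult]
    bounded_bilinear.FDERIV[OF bounded_bilinear_matrix_vector_mult]
    bounded_linear.has_derivative[OF bounded_linear_transpose]
    bounded_linear.has_derivative[OF bounded_linear_axial]
  \<comment> \<open>\<open>?F\<close> is smooth on the whole ambient space, so any \<open>S\<close>
    will do, in particular the group.\<close>
  have "(?F has_derivative
     (\<lambda>H. ((R ** fst (fst H),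
            transpose (fst (fst H)) *v b - axial (snd (fst H))),
           transpose (fst (fst H)) ** C + C ** snd H))) (at ((mat 1, 0), mat 1) within S)" for S
    by (rule derivative_eq_intros refl)+
      (simp add: fun_eq_iff axial_0 bounded_bilinear.zero_left[OF bounded_bilinear_matrix_mult]
        del: transpose_matrix_vector)
  then show "(?F has_derivative (\<lambda>((\<gamma>, \<zeta>), \<kappa>).
      ((R ** \<gamma>, transpose \<gamma> *v b - axial \<zeta>), transpose \<gamma> ** C + C ** \<kappa>)))
    (at \<one>\<^bsub>GG\<^esub> within carrier GG)"
    by (simp add: GG_def split_def del: transpose_matrix_vector)
qed

text \<open>The first entry of \<open>Lam\<close> moves \<open>R\<close> as the system prescribes.
  The other two cancel the motion that the factor \<open>transpose A\<close> in \<open>phi\<close>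
  would otherwise induce in \<open>b\<close> and \<open>C\<close>.\<close>

lemma is_lift_Lam: "is_lift phi sysf Lam"
  unfolding is_lift_def
proof (intro ballI conjI)
  fix \<xi> u assume \<xi>: "\<xi> \<in> MM" and u: "u \<in> LL"
  obtain R b C where \<xi>_eq: "\<xi> = ((R, b), C)" and C: "C \<in> SO3"
    using \<xi> by (auto simp: MM_def)
  obtain \<omega> where u_eq: "u = (\<omega>, 0, 0)"
    using u by (auto simp: LL_def)
  show "Lam \<xi> u \<in> gg"
    using so3_conj[OF wedge_in_so3, of "transpose C" "\<omega> - b"]
    by (simp add: \<xi>_eq u_eq Lam_def gg_def C SO3_closed so3_linear wedge_in_so3)
  let ?D = "\<lambda>((\<gamma>, \<zeta>), \<kappa>).
    ((R ** \<gamma>, transpose \<gamma> *v b - axial \<zeta>), transpose \<gamma> ** C + C ** \<kappa>)"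
  have "transpose (wedge (\<omega> - b)) = wedge (- (\<omega> - b))"
    using wedge_in_so3[of "\<omega> - b"] by (simp only: so3_def wedge_minus) simp
  \<comment> \<open>The bias stays constant: both terms reduce to multiples of
    \<open>cross3 \<omega> b\<close>, because \<open>cross3 b b\<close> vanishes.\<close>
  moreover have "cross3 (- (\<omega> - b)) b + cross3 \<omega> b = 0"
    by (simp add: cross3_def vec_eq_iff forall_3 algebra_simps)
  \<comment> \<open>Conjugating by \<open>C\<close> in the third entry of \<open>Lam\<close> moves
    the angular velocity to the left of \<open>C\<close>, where it meets its transpose.\<close>
  moreover have "C ** (transpose C ** wedge (\<omega> - b) ** C) = wedge (\<omega> - b) ** C"
    by (simp add: matrix_mul_assoc SO3_inverse C)
  moreover have "wedge (- (\<omega> - b)) ** C + wedge (\<omega> - b) ** C = wedge 0"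
    unfolding wedge_minus by (simp add: minus_matrix_mult vec_eq_iff forall_3 wedge_nth)
  ultimately have "?D (Lam \<xi> u) = sysf \<xi> u"
    by (simp add: \<xi>_eq u_eq Lam_def sysf_def wedge_mult axial_wedge
        del: transpose_matrix_vector minus_diff_eq flip: wedge_minus)
  then show "\<exists>D. ((\<lambda>X. phi X \<xi>) has_derivative D) (at \<one>\<^bsub>GG\<^esub> within carrier GG) \<and>
      D (Lam \<xi> u) = sysf \<xi> u"
    using phi_has_derivative[of R b C] \<xi>_eq by blast
qed

text \<open>Conjugation by a rotation acts on \<open>wedge v\<close> by rotating \<open>v\<close>,
  so the first two components reduce to vector identities; in the third the rotation
  \<open>A\<close> cancels.\<close>

lemma Ad_inv_Lam:
  assumes "X \<in> carrier GG" "\<xi> \<in> MM" "u \<in> LL"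
  shows "Ad (inv\<^bsub>GG\<^esub> X) (Lam \<xi> u) = Lam (phi X \<xi>) (psi X u)"
proof -
  obtain A a B where X: "X = ((A, a), B)" and A: "A \<in> SO3" and a: "a \<in> so3"
    using assms(1) by (auto simp: GG_def)
  obtain R b C where \<xi>: "\<xi> = ((R, b), C)"
    using assms(2) by (auto simp: MM_def)
  obtain \<omega> where u: "u = (\<omega>, 0, 0)"
    using assms(3) by (auto simp: LL_def)
  define \<alpha> where "\<alpha> = vee a"
  define T where "T = transpose A"
  have T: "T \<in> SO3" "transpose T = A"
    using A by (simp_all add: T_def SO3_closed)
  have conj: "T ** wedge v ** A = wedge (T *v v)" for v
    using wedge_rotate[OF T(1)] T(2) by simp
  have AT: "A ** T = mat 1"
    using A by (simp add: T_def SO3_inverse)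
  have cross_T: "cross3 (T *v v) (T *v w) = T *v cross3 v w" for v w
    using T(1) by (intro cross_rotation_matrix) (simp add: SO3_def)
  have a_eq: "a = wedge \<alpha>"
    by (simp add: \<alpha>_def wedge_vee a)
  \<comment> \<open>Both actions shift by the same \<alpha>, so the bias-corrected velocity is only
    rotated.\<close>
  have 1: "T *v (\<omega> - \<alpha>) - T *v (b - \<alpha>) = T *v (\<omega> - b)"
    by (simp flip: matrix_vector_mult_diff_distrib)
  \<comment> \<open>Expanding the shifted product leaves exactly the bracket term as correction,
    since \<open>cross3 \<alpha> \<alpha>\<close> is 0.\<close>
  have "- cross3 \<omega> b + cross3 (- \<alpha>) (\<omega> - b) = - cross3 (\<omega> - \<alpha>) (b - \<alpha>)"
    by (simp add: cross3_def vec_eq_iff forall_3 algebra_simps)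
  then have "T *v (- cross3 \<omega> b) + T *v cross3 (- \<alpha>) (\<omega> - b) = - (T *v cross3 (\<omega> - \<alpha>) (b - \<alpha>))"
    by (metis matrix_vector_right_distrib vec.neg)
  then have 2: "T ** (- wedge (cross3 \<omega> b)) ** A +
      commutator (- (T ** a ** A)) (T ** wedge (\<omega> - b) ** A)
    = - wedge (cross3 (T *v (\<omega> - \<alpha>)) (T *v (b - \<alpha>)))"
    by (simp add: a_eq conj commutator_wedge cross_T vec.neg flip: wedge_minus wedge_add)
  \<comment> \<open>Writing the rotated wedge as a conjugate by \<open>T\<close> creates two factors
    \<open>A ** T\<close>, which are the identity.\<close>
  have 3: "transpose (T ** C ** B) ** wedge (T *v (\<omega> - b)) ** (T ** C ** B)
    = transpose B ** (transpose C ** wedge (\<omega> - b) ** C) ** B"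
  proof -
    have "transpose (T ** C ** B) ** wedge (T *v (\<omega> - b)) ** (T ** C ** B)
      = transpose B ** transpose C ** (A ** T) ** wedge (\<omega> - b) ** (A ** T) ** C ** B"
      by (simp add: matrix_transpose_mul T matrix_mul_assoc flip: conj)
    then show ?thesis
      by (simp add: AT matrix_mul_assoc)
  qed
  have "inv\<^bsub>GG\<^esub> X = ((T, - (T ** a ** A)), transpose B)"
    using inv_GG assms(1) by (simp add: X T_def)
  then show ?thesis
    using 2 3
    by (simp add: X \<xi> u Ad_def Lam_def phi_def psi_def wedge_mult T 1 conj
        flip: T_def \<alpha>_def del: transpose_matrix_vector)
qed

theorem theorem4p2p8:
  shows "is_equivariant_lift phi psi sysf Lam"
  unfolding is_equivariant_lift_def using is_lift_Lam Ad_inv_Lam by blast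

end
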